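(* Let $\Sigma$ be an alphabet with $|\Sigma|=2$. For every $w\in\Sigma^+$, $\mathrm{cpr}_R(w)=\mathrm{cpr}_L(w)$.
   Context: $\Sigma^*$ is the set of words over $\Sigma$, $\lambda$ the empty word, $\Sigma^+=\Sigma^*\setminus\{\lambda\}$, $|v|$ the length of $v$. Right decomposition. For $w\in\Sigma^+$ let $R_w=\{(u,v,n)\in\Sigma^*\times\Sigma^+\times\mathbb{Z}^+ : w=uv^n\}$ and $\tau_r(w)=\max\{n : (u,v,n)\in R_w\}$. Define $\theta_r(w)$: if $\tau_r(w)=1$, $\theta_r(w)$ is the minimum of $\{|v| : v\in\Sigma^+,\ w=uv \text{ for some } u\in\Sigma^+ \text{ with } \tau_r(u)\neq 1\}$ if this set is nonempty, and $\theta_r(w)=|w|$ otherwise; if $\tau_r(w)>1$, $\theta_r(w)$ is the maximum of $\{|v| : v\in\Sigma^+,\ w=uv^{\tau_r(w)} \text{ for some } u\in\Sigma^*\}$. Let $\rho_r(w)=(u',v',\tau_r(w))$ be the unique element of $R_w$ with $|v'|=\theta_r(w)$. Set $w_0=w$, $(w_1,v_0,n_0)=\rho_r(w_0)$, and recursively $(w_{i+1},v_i,n_i)=\rho_r(w_i)$ while $w_i\neq\lambda$; let $k$ be the largest index with $w_k\ne\lambda$. The right general print is $\mathrm{gpr}_R(w)=v_kv_{k-1}\cdots v_0$. Left decomposition (mirror analogue, from left to right). For $w\in\Sigma^+$ let $L_w=\{(u,v,n)\in\Sigma^*\times\Sigma^+\times\mathbb{Z}^+ : w=v^nu\}$ and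 $\tau_l(w)=\max\{n:(u,v,n)\in L_w\}$. If $\tau_l(w)=1$, $\theta_l(w)$ is the minimum of $\{|v| : v\in\Sigma^+,\ w=vu \text{ for some } u\in\Sigma^+ \text{ with } \tau_l(u)\ne 1\}$ if nonempty, and $|w|$ otherwise; if $\tau_l(w)>1$, $\theta_l(w)$ is the maximum of $\{|v| : v\in\Sigma^+,\ w=v^{\tau_l(w)}u \text{ for some } u\in\Sigma^*\}$. Let $\rho_l(w)=(u',v',\tau_l(w))$ be the unique element of $L_w$ with $|v'|=\theta_l(w)$. Set $w_0=w$, $(w_1,u_0,m_0)=\rho_l(w_0)$, recursively $(w_{i+1},u_i,m_i)=\rho_l(w_i)$ while $w_i\ne\lambda$; with $j$ the largest index with $w_j\ne\lambda$, the left general print is $\mathrm{gpr}_L(w)=u_0u_1\cdots u_j$. Core prints. Let $w_0=w'_0=w$ and recursively $w_{i+1}=\mathrm{gpr}_R(w_i)$, $w'_{i+1}=\mathrm{gpr}_L(w'_i)$. If $I$ (resp. $I'$) is the least nonnegative integer with $w_I=w_{I+1}$ (resp. $w'_{I'}=w'_{I'+1}$), then the right core print is $\mathrm{cpr}_R(w)=w_I$ and the left core print is $\mathrm{cpr}_L(w)=w'_{I'}$. *)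

theory Defs
  imports Main
begin

text \<open>Words are lists. The alphabet does not enter the definitions: every factor of a word
  over \<open>\<Sigma>\<close> is again a word over \<open>\<Sigma>\<close>. Prints are only meaningful for nonempty words, and
  \<open>rest_r\<close>, \<open>rest_l\<close> are continued with the empty word once it has been reached.\<close>

definition word_pow :: "'a list \<Rightarrow> nat \<Rightarrow> 'a list" where
  "word_pow v n = concat (replicate n v)"

definition right_decomps :: "'a list \<Rightarrow> ('a list \<times> 'a list \<times> nat) set" where
  "right_decomps w = {(u, v, n). v \<noteq> [] \<and> n \<ge> 1 \<and> w = u @ word_pow v n}"

definition tau_r :: "'a list \<Rightarrow> nat" where
  "tau_r w = Max {n. \<exists>u v. (u, v, n) \<in> right_decomps w}"

definition theta_r :: "'a list \<Rightarrow> nat" where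
  "theta_r w =
    (if tau_r w = 1 then
       let D = {length v | u v. u \<noteq> [] \<and> v \<noteq> [] \<and> w = u @ v \<and> tau_r u \<noteq> 1}
       in if D \<noteq> {} then Min D else length w
     else Max {length v | u v. v \<noteq> [] \<and> w = u @ word_pow v (tau_r w)})"

definition rho_r :: "'a list \<Rightarrow> 'a list \<times> 'a list \<times> nat" where
  "rho_r w = (THE (u, v, n). (u, v, n) \<in> right_decomps w \<and> n = tau_r w \<and> length v = theta_r w)"

fun rest_r :: "'a list \<Rightarrow> nat \<Rightarrow> 'a list" where
  "rest_r w 0 = w"
| "rest_r w (Suc i) = (if rest_r w i = [] then [] else fst (rho_r (rest_r w i)))"

definition factor_r :: "'a list \<Rightarrow> nat \<Rightarrow> 'a list" where
  "factor_r w i = fst (snd (rho_r (rest_r w i)))"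

definition last_index_r :: "'a list \<Rightarrow> nat" where
  "last_index_r w = (GREATEST k. rest_r w k \<noteq> [])"

definition gpr_R :: "'a list \<Rightarrow> 'a list" where
  "gpr_R w = concat (map (factor_r w) (rev [0..<Suc (last_index_r w)]))"

definition cpr_R :: "'a list \<Rightarrow> 'a list" where
  "cpr_R w = (gpr_R ^^ (LEAST i. (gpr_R ^^ i) w = (gpr_R ^^ Suc i) w)) w"

definition left_decomps :: "'a list \<Rightarrow> ('a list \<times> 'a list \<times> nat) set" where
  "left_decomps w = {(u, v, n). v \<noteq> [] \<and> n \<ge> 1 \<and> w = word_pow v n @ u}"

definition tau_l :: "'a list \<Rightarrow> nat" where
  "tau_l w = Max {n. \<exists>u v. (u, v, n) \<in> left_decomps w}"

definition theta_l :: "'a list \<Rightarrow> nat" where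
  "theta_l w =
    (if tau_l w = 1 then
       let D = {length v | u v. u \<noteq> [] \<and> v \<noteq> [] \<and> w = v @ u \<and> tau_l u \<noteq> 1}
       in if D \<noteq> {} then Min D else length w
     else Max {length v | u v. v \<noteq> [] \<and> w = word_pow v (tau_l w) @ u})"

definition rho_l :: "'a list \<Rightarrow> 'a list \<times> 'a list \<times> nat" where
  "rho_l w = (THE (u, v, n). (u, v, n) \<in> left_decomps w \<and> n = tau_l w \<and> length v = theta_l w)"

fun rest_l :: "'a list \<Rightarrow> nat \<Rightarrow> 'a list" where
  "rest_l w 0 = w"
| "rest_l w (Suc i) = (if rest_l w i = [] then [] else fst (rho_l (rest_l w i)))"

definition factor_l :: "'a list \<Rightarrow> nat \<Rightarrow> 'a list" where
  "factor_l w i = fst (snd (rho_l (rest_l w i)))"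

definition last_index_l :: "'a list \<Rightarrow> nat" where
  "last_index_l w = (GREATEST k. rest_l w k \<noteq> [])"

definition gpr_L :: "'a list \<Rightarrow> 'a list" where
  "gpr_L w = concat (map (factor_l w) [0..<Suc (last_index_l w)])"

definition cpr_L :: "'a list \<Rightarrow> 'a list" where
  "cpr_L w = (gpr_L ^^ (LEAST i. (gpr_L ^^ i) w = (gpr_L ^^ Suc i) w)) w"

end

theory Submission
  imports Defs
begin

text \<open>Passing from a word to its general print keeps the first letter, the last letter and the set
  of letters. The print is strictly shorter if the word contains a square, and equals the word
  otherwise, so the iteration stops at a square-free word. A square-free binary word has length at
  most 3 and is determined by its first letter, its last letter and its letters. Reversal
  exchanges the left and the right print.\<close>

section \<open>Squares and square-free binary words\<close>

definition has_square :: "'a list \<Rightarrow> bool" where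
  "has_square w \<longleftrightarrow> (\<exists>x y z. y \<noteq> [] \<and> w = x @ y @ y @ z)"

lemma has_square_appendI1: "has_square u \<Longrightarrow> has_square (u @ v)"
  unfolding has_square_def by (metis append_assoc)

lemma has_square_rev [simp]: "has_square (rev w) \<longleftrightarrow> has_square w"
proof -
  have "has_square (rev w)" if "has_square w" for w :: "'a list"
  proof -
    from that obtain x y z where "y \<noteq> []" "w = x @ y @ y @ z"
      unfolding has_square_def by blast
    then have "rev y \<noteq> []" "rev w = rev z @ rev y @ rev y @ rev x" by auto
    then show ?thesis unfolding has_square_def by blast
  qed
  from this[of w] this[of "rev w"] show ?thesis by auto
qed

text \<open>Letters are peeled off one at a time: neighbours must differ, so the word alternates,
  and a fourth letter completes a square of a two-letter word.\<close>

lemma square_free_binary_cases: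
  assumes "set w \<subseteq> {a, b}" and "w \<noteq> []" and sf: "\<not> has_square w"
  shows "w \<in> {[a], [b], [a, b], [b, a], [a, b, a], [b, a, b]}"
proof -
  have ne: "y = [] \<or> w \<noteq> x @ y @ y @ z" for x y z
    using sf unfolding has_square_def by blast
  obtain p t where w1: "w = p # t" using \<open>w \<noteq> []\<close> by (cases w) auto
  show ?thesis
  proof (cases t)
    case Nil
    then show ?thesis using assms w1 by auto
  next
    case (Cons q t')
    note w2 = this
    have pq: "p \<noteq> q" using ne[of "[p]" "[]" t'] w1 w2 by auto
    show ?thesis
    proof (cases t')
      case Nil
      then show ?thesis using assms w1 w2 pq by auto
    next
      case (Cons r t'')
      note w3 = this
      have qr: "q \<noteq> r" using ne[of "[q]" "[p]" t''] w1 w2 w3 by auto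
      show ?thesis
      proof (cases t'')
        case Nil
        then show ?thesis using assms w1 w2 w3 pq qr by auto
      next
        case (Cons s t3)
        have "r \<noteq> s" using ne[of "[r]" "[p, q]" t3] w1 w2 w3 Cons by auto
        \<comment> \<open>Over two letters, \<open>p \<noteq> q\<close>, \<open>q \<noteq> r\<close>
          and \<open>r \<noteq> s\<close> force \<open>p = r\<close> and \<open>q = s\<close>, so a
          fourth letter is contradictory.\<close>
        moreover have "\<not> (p = r \<and> q = s)"
          using ne[of "[p, q]" "[]" t3] w1 w2 w3 Cons by auto
        ultimately show ?thesis using assms w1 w2 w3 Cons pq qr by auto
      qed
    qed
  qed
qed

text \<open>Among the six possible words, the first and last letters leave only the pairs
  \<open>[a]\<close>, \<open>[a, b, a]\<close> and \<open>[b]\<close>, \<open>[b, a, b]\<close>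
  undecided; the letter set separates these.\<close>

lemma square_free_binary_eqI:
  assumes "a \<noteq> b" "set v \<subseteq> {a, b}" "v \<noteq> []" "w \<noteq> []" "\<not> has_square v" "\<not> has_square w"
    and "set v = set w" "hd v = hd w" "last v = last w"
  shows "v = w"
  using assms square_free_binary_cases[of v a b] square_free_binary_cases[of w a b] by auto

section \<open>The right decomposition\<close>

lemma word_pow_Suc [simp]: "word_pow v (Suc n) = v @ word_pow v n"
  by (simp add: word_pow_def)

lemma word_pow_0 [simp]: "word_pow v 0 = []"
  by (simp add: word_pow_def)

lemma word_pow_one [simp]: "word_pow v 1 = v"
  by (simp add: word_pow_def)

lemma length_word_pow [simp]: "length (word_pow v n) = n * length v"
  by (induction n) auto

lemma set_word_pow: "n \<ge> 1 \<Longrightarrow> set (word_pow v n) = set v"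
  by (simp add: word_pow_def)

lemma last_word_pow: "n \<ge> 1 \<Longrightarrow> v \<noteq> [] \<Longrightarrow> last (word_pow v n) = last v"
proof (induction n)
  case (Suc n)
  then show ?case by (cases n) auto
qed simp

lemma word_pow_eq_Nil_iff [simp]: "word_pow v n = [] \<longleftrightarrow> n = 0 \<or> v = []"
  by (cases n) (auto simp: word_pow_def)

lemma rev_word_pow: "rev (word_pow v n) = word_pow (rev v) n"
  by (simp add: word_pow_def rev_concat)

text \<open>Equal exponents and equal root lengths give powers of equal length, so both
  factorizations cut the word at the same place. This is the uniqueness behind
  \<open>rho_r\<close>.\<close>

lemma word_pow_suffix_unique:
  assumes "u @ word_pow v n = u' @ word_pow v' n" "length v = length v'" "n \<ge> 1"
  shows "u = u' \<and> v = v'"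
proof -
  have "word_pow v n = word_pow v' n" "u = u'"
    using assms append_eq_append_conv[of "word_pow v n" "word_pow v' n" u u']
    by (auto simp: append_eq_append_conv)
  with assms show ?thesis by (cases n) auto
qed

text \<open>Each of the \<open>n\<close> copies of \<open>v\<close> takes up at least one letter, so
  \<open>n \<le> length w\<close>; hence the \<open>Max\<close> in \<open>tau_r\<close> is a genuine
  maximum.\<close>

lemma finite_right_exponents: "finite {n. \<exists>u v. (u, v, n) \<in> right_decomps w}"
proof (rule finite_subset)
  show "{n. \<exists>u v. (u, v, n) \<in> right_decomps w} \<subseteq> {..length w}"
  proof
    fix n assume "n \<in> {n. \<exists>u v. (u, v, n) \<in> right_decomps w}"
    then obtain u v where *: "v \<noteq> []" "w = u @ word_pow v n"
      by (auto simp: right_decomps_def)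
    have "n \<le> n * length v" using *(1) by (cases v) auto
    also have "\<dots> \<le> length w" using *(2) by simp
    finally show "n \<in> {..length w}" by simp
  qed
qed simp

lemma tau_r_ge: "(u, v, n) \<in> right_decomps w \<Longrightarrow> n \<le> tau_r w"
  unfolding tau_r_def by (rule Max_ge[OF finite_right_exponents]) blast

lemma tau_r_attained:
  assumes "w \<noteq> []"
  shows "\<exists>u v. (u, v, tau_r w) \<in> right_decomps w"
proof -
  have "([], w, 1) \<in> right_decomps w" using assms by (simp add: right_decomps_def)
  then show ?thesis
    using Max_in[OF finite_right_exponents, of w] unfolding tau_r_def by blast
qed

lemma tau_r_ge_1: "w \<noteq> [] \<Longrightarrow> tau_r w \<ge> 1"
  using tau_r_attained[of w] by (auto simp: right_decomps_def)

lemma tau_r_square: "y \<noteq> [] \<Longrightarrow> tau_r (x @ y @ y) \<noteq> 1"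
  using tau_r_ge[of x y 2 "x @ y @ y"] by (simp add: right_decomps_def numeral_2_eq_2)

text \<open>In each branch of \<open>theta_r\<close> the lengths come from a finite set, so the
  extremum is attained. The last conjunct records the minimum branch: if some nonempty prefix has
  \<open>tau_r\<close> different from 1, the remainder \<open>u\<close> is such a prefix
  too.\<close>

lemma theta_r_attained:
  assumes "w \<noteq> []"
  shows "\<exists>u v. (u, v, tau_r w) \<in> right_decomps w \<and> length v = theta_r w \<and>
           ((\<exists>p q. w = p @ q \<and> p \<noteq> [] \<and> tau_r p \<noteq> 1) \<and> tau_r w = 1 \<longrightarrow> u \<noteq> [] \<and> tau_r u \<noteq> 1)"
proof (cases "tau_r w = 1")
  case True
  define D where "D = {length v | u v. u \<noteq> [] \<and> v \<noteq> [] \<and> w = u @ v \<and> tau_r u \<noteq> 1}"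
  have th: "theta_r w = (if D \<noteq> {} then Min D else length w)"
    unfolding theta_r_def D_def[symmetric] Let_def using True by simp
  show ?thesis
  proof (cases "D = {}")
    case D: True
    have "q = []" if "w = p @ q" "p \<noteq> []" "tau_r p \<noteq> 1" for p q
      using that D unfolding D_def by blast
    \<comment> \<open>With \<open>q = []\<close> the prefix \<open>p\<close> would be
      \<open>w\<close> itself, whose \<open>tau_r\<close> is 1.\<close>
    then have "\<not> (\<exists>p q. w = p @ q \<and> p \<noteq> [] \<and> tau_r p \<noteq> 1)"
      using True by (metis append_Nil2)
    then show ?thesis
      using th D True assms
      by (intro exI[of _ "[]"] exI[of _ w]) (auto simp: right_decomps_def)
  next
    case False
    have "finite D"
      by (rule finite_subset[of _ "{..length w}"]) (auto simp: D_def)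
    from Min_in[OF this False] obtain u v where
      "Min D = length v" "u \<noteq> []" "v \<noteq> []" "w = u @ v" "tau_r u \<noteq> 1"
      unfolding D_def by blast
    then show ?thesis
      using th False True
      by (intro exI[of _ u] exI[of _ v]) (auto simp: right_decomps_def)
  qed
next
  case False
  define D where "D = {length v | u v. v \<noteq> [] \<and> w = u @ word_pow v (tau_r w)}"
  have "length v \<le> length w" if "w = u @ word_pow v (tau_r w)" for u v
  proof -
    have "1 * length v \<le> tau_r w * length v"
      using tau_r_ge_1[OF assms] by (intro mult_right_mono) auto
    also have "\<dots> \<le> length w" using arg_cong[OF that, of length] by simp
    finally show ?thesis by simp
  qed
  then have "finite D"
    by (intro finite_subset[of D "{..length w}"]) (auto simp: D_def)
  moreover have "D \<noteq> {}"
    using tau_r_attained[OF assms] unfolding D_def right_decomps_def by blast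
  ultimately have "Max D \<in> D" by (rule Max_in)
  then obtain u v where "Max D = length v" "v \<noteq> []" "w = u @ word_pow v (tau_r w)"
    unfolding D_def by blast
  moreover have "theta_r w = Max D" using False by (simp add: theta_r_def D_def)
  ultimately show ?thesis
    using False tau_r_ge_1[OF assms]
    by (intro exI[of _ u] exI[of _ v]) (simp add: right_decomps_def)
qed

lemma rho_r_eqI:
  assumes "(u, v, tau_r w) \<in> right_decomps w" "length v = theta_r w"
  shows "rho_r w = (u, v, tau_r w)"
  unfolding rho_r_def
proof (rule the_equality)
  fix t
  assume t: "case t of (u, v, n) \<Rightarrow>
    (u, v, n) \<in> right_decomps w \<and> n = tau_r w \<and> length v = theta_r w"
  obtain u' v' n where t': "t = (u', v', n)" by (cases t)
  with t have n: "n = tau_r w" and len: "length v' = length v"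
    and mem: "(u', v', n) \<in> right_decomps w"
    using assms(2) by auto
  have "w = u' @ word_pow v' n" "w = u @ word_pow v n" "n \<ge> 1"
    using mem assms(1)[folded n] unfolding right_decomps_def by blast+
  then have "u' = u \<and> v' = v" using len by (intro word_pow_suffix_unique[of _ _ n]) metis+
  then show "t = (u, v, tau_r w)" using t' n by simp
qed (use assms in auto)

lemma rho_r_cases:
  assumes "w \<noteq> []"
  obtains u v n where "rho_r w = (u, v, n)" "w = u @ word_pow v n" "v \<noteq> []" "n \<ge> 1"
    "tau_r w = n" "length v = theta_r w"
    "\<And>p q. w = p @ q \<Longrightarrow> p \<noteq> [] \<Longrightarrow> tau_r p \<noteq> 1 \<Longrightarrow> n = 1 \<Longrightarrow> u \<noteq> [] \<and> tau_r u \<noteq> 1"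
proof -
  from theta_r_attained[OF assms] obtain u v where
    *: "(u, v, tau_r w) \<in> right_decomps w" "length v = theta_r w"
       "(\<exists>p q. w = p @ q \<and> p \<noteq> [] \<and> tau_r p \<noteq> 1) \<and> tau_r w = 1 \<longrightarrow> u \<noteq> [] \<and> tau_r u \<noteq> 1"
    by blast
  have dec: "w = u @ word_pow v (tau_r w)" "v \<noteq> []" "tau_r w \<ge> 1"
    using *(1) unfolding right_decomps_def mem_Collect_eq prod.case by blast+
  show ?thesis
  proof (rule that[OF rho_r_eqI[OF *(1,2)] dec refl *(2)])
    show "u \<noteq> [] \<and> tau_r u \<noteq> 1"
      if "w = p @ q" "p \<noteq> []" "tau_r p \<noteq> 1" "tau_r w = 1" for p q
      using *(3) that by blast
  qed
qed

section \<open>The right general print\<close>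

lemma rest_r_Nil [simp]: "rest_r [] i = []"
  by (induction i) auto

text \<open>\<open>rest_r\<close> unfolds at the last step; taking off the first step instead
  prepares for induction on the word.\<close>

lemma rest_r_Suc_shift: "w \<noteq> [] \<Longrightarrow> rest_r w (Suc i) = rest_r (fst (rho_r w)) i"
  by (induction i) auto

lemma length_fst_rho_r: "w \<noteq> [] \<Longrightarrow> length (fst (rho_r w)) < length w"
proof (erule rho_r_cases)
  fix u v n
  assume "rho_r w = (u, v, n)" and w: "w = u @ word_pow v n" and "v \<noteq> []" "n \<ge> 1"
  then show "length (fst (rho_r w)) < length w" using arg_cong[OF w, of length] by simp
qed

lemma rest_r_nonempty_index_le:
  assumes "rest_r w k \<noteq> []" shows "k \<le> length w"
proof -
  \<comment> \<open>Strengthened for the induction: every step removes at least one letter. The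
    bound on \<open>k\<close> makes the \<open>GREATEST\<close> in \<open>last_index_r\<close>
    meaningful.\<close>
  have "k + length (rest_r w k) \<le> length w"
    using assms
  proof (induction k)
    case (Suc k)
    then have "rest_r w k \<noteq> []" by auto
    with Suc length_fst_rho_r[of "rest_r w k"] show ?case by auto
  qed simp
  then show ?thesis by simp
qed

lemma last_index_r_rec:
  assumes "w \<noteq> []"
  shows "last_index_r w =
    (if fst (rho_r w) = [] then 0 else Suc (last_index_r (fst (rho_r w))))"
proof (cases "fst (rho_r w) = []")
  case True
  have "k \<le> 0" if "rest_r w k \<noteq> []" for k
    using that True rest_r_Suc_shift[OF assms] by (cases k) auto
  then show ?thesis
    unfolding last_index_r_def using True assms by (auto intro!: Greatest_equality)
next
  case False
  define u where "u = fst (rho_r w)"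
  have u: "rest_r u (last_index_r u) \<noteq> []"
    unfolding last_index_r_def
    by (rule GreatestI_nat[of _ 0 "length u"])
      (use False u_def rest_r_nonempty_index_le in auto)
  have le: "k \<le> last_index_r u" if "rest_r u k \<noteq> []" for k
    unfolding last_index_r_def
    by (rule Greatest_le_nat[of _ k "length u"]) (use that rest_r_nonempty_index_le in auto)
  have "last_index_r w = Suc (last_index_r u)"
    unfolding last_index_r_def[of w]
  proof (rule Greatest_equality)
    show "rest_r w (Suc (last_index_r u)) \<noteq> []"
      using u rest_r_Suc_shift[OF assms] by (simp add: u_def)
  next
    fix k assume "rest_r w k \<noteq> []"
    then show "k \<le> Suc (last_index_r u)"
      using le rest_r_Suc_shift[OF assms] by (cases k) (auto simp: u_def)
  qed
  with False show ?thesis by (simp add: u_def)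
qed

text \<open>Turns the index-based definition into a recursion along \<open>rho_r\<close>, suitable
  for induction on the length of the word.\<close>

lemma gpr_R_rec:
  assumes "w \<noteq> []" "rho_r w = (u, v, n)"
  shows "gpr_R w = (if u = [] then v else gpr_R u @ v)"
proof (cases "u = []")
  case True
  then show ?thesis
    using assms by (simp add: gpr_R_def last_index_r_rec factor_r_def)
next
  case False
  have shift: "factor_r w (Suc i) = factor_r u i" for i
    unfolding factor_r_def using rest_r_Suc_shift[OF assms(1)] assms(2) by (metis fst_conv)
  have "last_index_r w = Suc (last_index_r u)"
    using False assms by (simp add: last_index_r_rec)
  \<comment> \<open>Index 0 belongs to \<open>v\<close>, which the reversal of the index list puts
    last; the shifted indices produce the print of \<open>u\<close>.\<close>
  then have "[0..<Suc (last_index_r w)] = 0 # map Suc [0..<Suc (last_index_r u)]"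
    by (simp add: upt_conv_Cons map_Suc_upt del: upt_Suc)
  then show ?thesis
    using False assms(2)
    by (simp add: gpr_R_def rev_map shift comp_def factor_r_def[of w 0] del: upt_Suc)
qed

text \<open>Collects what the core print argument uses of a print, in a form that is symmetric under
  reversal and so serves both directions.\<close>

definition print_of :: "'a list \<Rightarrow> 'a list \<Rightarrow> bool" where
  "print_of w g \<longleftrightarrow> g \<noteq> [] \<and> hd g = hd w \<and> last g = last w \<and> set g = set w \<and>
     (if has_square w then length g < length w else g = w)"

text \<open>Induction on length via \<open>w = u @ word_pow v n\<close>. A square in
  \<open>w\<close> shortens the print either inside \<open>u\<close>, when \<open>n = 1\<close>, or
  by dropping copies of \<open>v\<close>. Without squares \<open>n = 1\<close> and \<open>u\<close>
  is reproduced unchanged.\<close>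

lemma print_of_gpr_R: "w \<noteq> [] \<Longrightarrow> print_of w (gpr_R w)"
proof (induction "length w" arbitrary: w rule: less_induct)
  case less
  obtain u v n where r: "rho_r w = (u, v, n)" "w = u @ word_pow v n" "v \<noteq> []" "n \<ge> 1"
    "tau_r w = n"
    and drop: "\<And>p q. w = p @ q \<Longrightarrow> p \<noteq> [] \<Longrightarrow> tau_r p \<noteq> 1 \<Longrightarrow> n = 1 \<Longrightarrow> u \<noteq> [] \<and> tau_r u \<noteq> 1"
    using rho_r_cases[OF less.prems] by metis
  have rec: "gpr_R w = (if u = [] then v else gpr_R u @ v)"
    by (rule gpr_R_rec[OF less.prems r(1)])
  have IH: "print_of u (gpr_R u)" if "u \<noteq> []"
    using less.hyps[OF _ that] r(1) length_fst_rho_r[OF less.prems] by simp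
  then have IHs: "gpr_R u \<noteq> []" "hd (gpr_R u) = hd u" "last (gpr_R u) = last u"
    "set (gpr_R u) = set u" "length (gpr_R u) \<le> length u"
    "has_square u \<Longrightarrow> length (gpr_R u) < length u"
    "\<not> has_square u \<Longrightarrow> gpr_R u = u" if "u \<noteq> []"
    using that by (auto simp: print_of_def split: if_splits)
  have tau_square: "has_square p" if p: "p \<noteq> []" "tau_r p \<noteq> 1" for p :: "'a list"
  proof -
    from tau_r_attained[OF p(1)] obtain x y where
      xy: "y \<noteq> []" "p = x @ word_pow y (tau_r p)"
      by (auto simp: right_decomps_def)
    obtain m where "tau_r p = Suc (Suc m)"
      using p(2) tau_r_ge_1[OF p(1)] by (metis One_nat_def Suc_le_D not0_implies_Suc)
    with xy show ?thesis
      unfolding has_square_def by (metis word_pow_Suc)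
  qed
  have hd_pow: "hd (word_pow v n) = hd v"
    using r(3,4) by (cases n) auto
  have "length (gpr_R w) < length w" if sq: "has_square w"
  proof (cases "n = 1")
    case True
    from sq obtain x y z where y: "y \<noteq> []" "w = (x @ y @ y) @ z"
      unfolding has_square_def by auto
    \<comment> \<open>The prefix ending with the square has exponent at least 2, so the choice made
      by \<open>theta_r\<close> leaves a remainder \<open>u\<close> that ends in a square.\<close>
    then have "u \<noteq> [] \<and> tau_r u \<noteq> 1"
      using drop[of "x @ y @ y" z] tau_r_square[OF y(1)] True by auto
    then show ?thesis
      using IHs(6) tau_square[of u] rec True r(2) by simp
  next
    case False
    then obtain m where "n = Suc (Suc m)"
      using r(4) by (metis One_nat_def Suc_le_D not0_implies_Suc)
    \<comment> \<open>Two copies of \<open>v\<close> fit into \<open>w\<close> after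
      \<open>u\<close>, while the print keeps only one.\<close>
    then have "length w \<ge> length u + length v + length v"
      using arg_cong[OF r(2), of length] by simp
    moreover have "length v > 0" using r(3) by simp
    moreover have "length (gpr_R w) \<le> length u + length v" using rec IHs(5) by auto
    ultimately show ?thesis by linarith
  qed
  moreover have "gpr_R w = w" if sf: "\<not> has_square w"
  proof -
    have "n = 1" using sf tau_square[OF less.prems] r(5) by auto
    moreover have "\<not> has_square u"
      using sf has_square_appendI1 r(2) by blast
    ultimately show ?thesis using rec r(2) IHs(7) by auto
  qed
  moreover have "gpr_R w \<noteq> []" "hd (gpr_R w) = hd w" "last (gpr_R w) = last w"
      "set (gpr_R w) = set w"
    using rec r(2-4) IHs hd_pow last_word_pow[of n v] set_word_pow[of n v] by auto
  ultimately show ?case by (simp add: print_of_def)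
qed

section \<open>The left general print\<close>

lemma left_decomps_rev:
  "(u, v, n) \<in> left_decomps w \<longleftrightarrow> (rev u, rev v, n) \<in> right_decomps (rev w)"
proof -
  have "w = word_pow v n @ u \<longleftrightarrow> rev w = rev u @ word_pow (rev v) n"
    by (metis rev_append rev_rev_ident rev_word_pow)
  then show ?thesis by (simp add: left_decomps_def right_decomps_def)
qed

lemma tau_l_rev: "tau_l w = tau_r (rev w)"
proof -
  have "{n. \<exists>u v. (u, v, n) \<in> left_decomps w} =
        {n. \<exists>u v. (u, v, n) \<in> right_decomps (rev w)}"
    unfolding left_decomps_rev by (metis rev_rev_ident)
  then show ?thesis by (simp add: tau_l_def tau_r_def)
qed

text \<open>Reversing both factors preserves lengths and matches the left factorizations of
  \<open>w\<close> with the right ones of \<open>rev w\<close>, so the sets under \<open>Min\<close>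
  (\<open>D\<close>) and \<open>Max\<close> (\<open>M\<close>) coincide.\<close>

lemma theta_l_rev: "theta_l w = theta_r (rev w)"
proof -
  have D: "{length v | u v. u \<noteq> [] \<and> v \<noteq> [] \<and> w = v @ u \<and> tau_l u \<noteq> 1} =
        {length v | u v. u \<noteq> [] \<and> v \<noteq> [] \<and> rev w = u @ v \<and> tau_r u \<noteq> 1}" (is "?A = ?B")
  proof (intro set_eqI iffI)
    fix k assume "k \<in> ?A"
    then obtain u v where
      *: "k = length v" "u \<noteq> []" "v \<noteq> []" "w = v @ u" "tau_l u \<noteq> 1" by blast
    show "k \<in> ?B"
      by (rule CollectI, rule exI[of _ "rev u"], rule exI[of _ "rev v"])
        (use * in \<open>auto simp: tau_l_rev\<close>)
  next
    fix k assume "k \<in> ?B"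
    then obtain u v where
      *: "k = length v" "u \<noteq> []" "v \<noteq> []" "rev w = u @ v" "tau_r u \<noteq> 1" by blast
    have "w = rev v @ rev u" using *(4) by (metis rev_append rev_rev_ident)
    then show "k \<in> ?A"
      by (intro CollectI exI[of _ "rev u"] exI[of _ "rev v"])
        (use * in \<open>auto simp: tau_l_rev\<close>)
  qed
  have M: "{length v | u v. v \<noteq> [] \<and> w = word_pow v n @ u} =
        {length v | u v. v \<noteq> [] \<and> rev w = u @ word_pow v n}" (is "?A = ?B") for n
  proof (intro set_eqI iffI)
    fix k assume "k \<in> ?A"
    then obtain u v where *: "k = length v" "v \<noteq> []" "w = word_pow v n @ u" by blast
    show "k \<in> ?B"
      by (rule CollectI, rule exI[of _ "rev u"], rule exI[of _ "rev v"])
        (use * in \<open>auto simp: rev_word_pow\<close>)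
  next
    fix k assume "k \<in> ?B"
    then obtain u v where *: "k = length v" "v \<noteq> []" "rev w = u @ word_pow v n" by blast
    have "w = word_pow (rev v) n @ rev u"
      using *(3) by (metis rev_append rev_rev_ident rev_word_pow)
    then show "k \<in> ?A"
      by (intro CollectI exI[of _ "rev u"] exI[of _ "rev v"]) (use * in auto)
  qed
  show ?thesis
    unfolding theta_l_def theta_r_def Let_def D M
    unfolding tau_l_rev length_rev ..
qed

text \<open>A candidate for \<open>rho_l w\<close>, when reversed, is a candidate for
  \<open>rho_r (rev w)\<close>, and \<open>rho_r_eqI\<close> leaves only one.\<close>

lemma rho_l_rev:
  assumes "w \<noteq> []" "rho_r (rev w) = (u, v, n)"
  shows "rho_l w = (rev u, rev v, n)"
  unfolding rho_l_def
proof (rule the_equality)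
  have "rev w \<noteq> []" using assms by simp
  then have uvn: "rev w = u @ word_pow v n" "v \<noteq> []" "n \<ge> 1"
      "tau_r (rev w) = n" "length v = theta_r (rev w)"
    by (rule rho_r_cases; use assms(2) in simp)+
  then show "case (rev u, rev v, n) of (u, v, n) \<Rightarrow>
      (u, v, n) \<in> left_decomps w \<and> n = tau_l w \<and> length v = theta_l w"
    by (simp add: left_decomps_rev tau_l_rev theta_l_rev right_decomps_def)
  fix t
  assume t: "case t of (u, v, n) \<Rightarrow>
      (u, v, n) \<in> left_decomps w \<and> n = tau_l w \<and> length v = theta_l w"
  obtain u' v' n' where t': "t = (u', v', n')" by (cases t)
  with t uvn(4) have "n' = n" "(rev u', rev v', tau_r (rev w)) \<in> right_decomps (rev w)"
      "length (rev v') = theta_r (rev w)"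
    by (auto simp: left_decomps_rev tau_l_rev theta_l_rev)
  then have "u = rev u'" "v = rev v'"
    using rho_r_eqI[of "rev u'" "rev v'" "rev w"] assms(2) by simp_all
  then show "t = (rev u, rev v, n)" using t' \<open>n' = n\<close> by simp
qed

lemma rest_l_rev: "rest_l w i = rev (rest_r (rev w) i)"
proof (induction i)
  case (Suc i)
  show ?case
  proof (cases "rest_l w i = []")
    case False
    obtain u v n where rho: "rho_r (rest_r (rev w) i) = (u, v, n)"
      by (cases "rho_r (rest_r (rev w) i)")
    have "rho_r (rev (rest_l w i)) = (u, v, n)" using rho by (simp add: Suc)
    from rho_l_rev[OF False this] have "rest_l w (Suc i) = rev u" using False by simp
    moreover have "rest_r (rev w) (Suc i) = u" using rho False Suc by simp
    ultimately show ?thesis by simp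
  qed (use Suc in auto)
qed simp

lemma last_index_l_rev: "last_index_l w = last_index_r (rev w)"
  by (simp add: last_index_l_def last_index_r_def rest_l_rev)

text \<open>Reversing a concatenation reverses each factor and their order, which matches the
  opposite index orders in the two prints.\<close>

lemma gpr_L_rev:
  assumes "w \<noteq> []"
  shows "gpr_L w = rev (gpr_R (rev w))"
proof -
  have idx: "rest_r (rev w) (last_index_r (rev w)) \<noteq> []"
    unfolding last_index_r_def
    by (rule GreatestI_nat[of _ 0 "length w"])
      (use assms rest_r_nonempty_index_le[of "rev w"] in auto)
  \<comment> \<open>Once empty, a remainder stays empty; so all remainders up to the last index are
    nonempty, as \<open>rho_l_rev\<close> requires.\<close>
  have mono: "rest_r (rev w) i \<noteq> []" if "rest_r (rev w) j \<noteq> []" "i \<le> j" for i j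
    using that(2,1) by (induction j rule: dec_induct) (auto split: if_splits)
  have "factor_l w i = rev (factor_r (rev w) i)" if "i \<le> last_index_r (rev w)" for i
  proof -
    have "rest_l w i \<noteq> []" using mono[OF idx that] by (simp add: rest_l_rev)
    moreover obtain u v n where rho: "rho_r (rest_r (rev w) i) = (u, v, n)"
      by (cases "rho_r (rest_r (rev w) i)")
    then have "rho_r (rev (rest_l w i)) = (u, v, n)" by (simp add: rest_l_rev)
    ultimately have "rho_l (rest_l w i) = (rev u, rev v, n)" by (rule rho_l_rev)
    with rho show ?thesis by (simp add: factor_l_def factor_r_def)
  qed
  then have "map (factor_l w) [0..<Suc (last_index_r (rev w))] =
      map (\<lambda>i. rev (factor_r (rev w) i)) [0..<Suc (last_index_r (rev w))]"
    by (intro map_cong) auto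
  then show ?thesis
    unfolding gpr_L_def gpr_R_def last_index_l_rev
    by (simp only: rev_concat rev_map rev_rev_ident map_map comp_def)
qed

lemma print_of_gpr_L:
  assumes "w \<noteq> []"
  shows "print_of w (gpr_L w)"
  using print_of_gpr_R[of "rev w"] assms gpr_L_rev[OF assms]
  by (auto simp: print_of_def hd_rev last_rev split: if_splits)

section \<open>Core prints\<close>

text \<open>Every iterate inherits the letter data of \<open>w\<close>, and lengths drop until a
  fixed point is reached. A fixed point has no square, since otherwise its print would be shorter.
  Stated for a general \<open>f\<close> to cover both prints.\<close>

lemma print_limit:
  assumes f: "\<And>w. w \<noteq> [] \<Longrightarrow> print_of w (f w)" and "w \<noteq> []"
    and c: "c = (f ^^ (LEAST i. (f ^^ i) w = (f ^^ Suc i) w)) w"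
  shows "c \<noteq> [] \<and> hd c = hd w \<and> last c = last w \<and> set c = set w \<and> \<not> has_square c"
proof -
  have inv: "(f ^^ i) w \<noteq> [] \<and> hd ((f ^^ i) w) = hd w \<and> last ((f ^^ i) w) = last w \<and>
      set ((f ^^ i) w) = set w" for i
  proof (induction i)
    case (Suc i)
    then show ?case using f[of "(f ^^ i) w"] by (auto simp: print_of_def)
  qed (use \<open>w \<noteq> []\<close> in simp)
  have "\<exists>i. (f ^^ i) w = (f ^^ Suc i) w"
  proof (rule ccontr)
    assume "\<nexists>i. (f ^^ i) w = (f ^^ Suc i) w"
    \<comment> \<open>An iterate that is not fixed must contain a square, so the next one is
      strictly shorter.\<close>
    then have dec: "length ((f ^^ Suc i) w) < length ((f ^^ i) w)" for i
      using f[of "(f ^^ i) w"] inv[of i]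
      by (metis comp_apply funpow.simps(2) print_of_def)
    \<comment> \<open>One letter is lost per step, which is impossible for
      \<open>Suc (length w)\<close> steps.\<close>
    have "i + length ((f ^^ i) w) \<le> length w" for i
    proof (induction i)
      case (Suc i)
      then show ?case using dec[of i] by simp
    qed simp
    from this[of "Suc (length w)"] show False by simp
  qed
  from LeastI_ex[OF this] have "f c = c" by (simp add: c)
  moreover have "c \<noteq> [] \<and> hd c = hd w \<and> last c = last w \<and> set c = set w"
    unfolding c by (rule inv)
  ultimately show ?thesis
    using f[of c] by (auto simp: print_of_def split: if_splits)
qed

theorem theorem3p16:
  fixes \<Sigma> :: "'a set" and w :: "'a list"
  assumes "card \<Sigma> = 2"
    and "w \<in> lists \<Sigma>" and "w \<noteq> []"
  shows "cpr_R w = cpr_L w"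
proof -
  obtain a b where "\<Sigma> = {a, b}" and ab: "a \<noteq> b" using assms(1) by (auto simp: card_2_iff)
  then have "set w \<subseteq> {a, b}" using assms(2) by auto
  moreover note print_limit[OF print_of_gpr_R assms(3) cpr_R_def]
    print_limit[OF print_of_gpr_L assms(3) cpr_L_def]
  ultimately show ?thesis
    by (intro square_free_binary_eqI[OF ab]) auto
qed

end
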